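(* Let $\alpha>1$ and $\mu>-1$ be real numbers. If $f\in\mathcal{R}$, then $\Omega_z^{\alpha,\mu}f\in\mathcal{R}\cap\mathcal{H}^{\infty}$.
   Context: Let $\mathbb{D}=\{z\in\mathbb{C}:|z|<1\}$. $\mathcal{H}$ is the class of analytic functions in $\mathbb{D}$, and $\mathcal{A}\subset\mathcal{H}$ is the class of functions of the form $f(z)=z+\sum_{n=2}^{\infty}a_nz^n$ ($z\in\mathbb{D}$). $\mathcal{R}$ is the class of $f\in\mathcal{A}$ with $\Re(f'(z))>0$ for all $z\in\mathbb{D}$. $\mathcal{H}^\infty$ is the space of bounded analytic functions in $\mathbb{D}$. For real $\alpha>0$ and $\mu>-1$, the operator $\Omega_z^{\alpha,\mu}:\mathcal{A}\to\mathcal{A}$ is defined, for $f(z)=z+\sum_{n=2}^\infty a_nz^n$, by $$\Omega_z^{\alpha,\mu}f(z)=\frac{(\mu+1)^{\alpha}\,\Gamma\left(\frac{1}{\mu+1}+\alpha+1\right)}{\Gamma\left(\frac{1}{\mu+1}+1\right)}z^{-\alpha(\mu+1)}I_z^{\alpha,\mu}f(z)=z+\sum_{n=2}^{\infty}\frac{\Gamma\left(\frac{1}{\mu+1}+\alpha+1\right)\Gamma\left(\frac{n}{\mu+1}+1\right)}{\Gamma\left(\frac{n}{\mu+1}+\alpha+1\right)\Gamma\left(\frac{1}{\mu+1}+1\right)}\,a_nz^n,$$ where $I_z^{\alpha,\mu}f(z)=\frac{(\mu+1)^{1-\alpha}}{\Gamma(\alpha)}\int_0^z(z^{\mu+1}-\xi^{\mu+1})^{\alpha-1}\xi^{\mu}f(\xi)\,d\xi$,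 the multiplicity of $(z^{\mu+1}-\xi^{\mu+1})^{\alpha-1}$ being removed by requiring $\log(z^{\mu+1}-\xi^{\mu+1})$ to be real when $z^{\mu+1}-\xi^{\mu+1}>0$. The power series expression may be taken as the definition of $\Omega_z^{\alpha,\mu}f$ on $\mathbb{D}$. *)

theory Defs
  imports "HOL-Complex_Analysis.Complex_Analysis"
begin

abbreviation unit_disc :: "complex set" where
  "unit_disc \<equiv> ball 0 1"

definition class_H :: "(complex \<Rightarrow> complex) set" where
  "class_H = {f. f holomorphic_on unit_disc}"

definition class_A :: "(complex \<Rightarrow> complex) set" where
  "class_A = {f \<in> class_H.
     \<exists>a :: nat \<Rightarrow> complex. \<forall>z\<in>unit_disc. (\<lambda>n. a (n + 2) * z ^ (n + 2)) sums (f z - z)}"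

definition class_R :: "(complex \<Rightarrow> complex) set" where
  "class_R = {f \<in> class_A. \<forall>z\<in>unit_disc. Re (deriv f z) > 0}"

definition class_H_inf :: "(complex \<Rightarrow> complex) set" where
  "class_H_inf = {f \<in> class_H. bounded (f ` unit_disc)}"

definition Omega_coeff :: "real \<Rightarrow> real \<Rightarrow> nat \<Rightarrow> real" where
  "Omega_coeff \<alpha> \<mu> n =
     (Gamma (1 / (\<mu> + 1) + \<alpha> + 1) * Gamma (real n / (\<mu> + 1) + 1)) /
     (Gamma (real n / (\<mu> + 1) + \<alpha> + 1) * Gamma (1 / (\<mu> + 1) + 1))"

text \<open>
  The power series form of the operator; the coefficients of \<open>f\<close> are its Taylor coefficients at
  \<open>0\<close>. For \<open>f \<in> class_A\<close>, \<open>\<alpha> > 0\<close> and \<open>\<mu> > -1\<close> all Gamma arguments are positive, and the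
  series converges on the unit disc because its multipliers decrease with the index from
  the value \<open>1\<close> at index \<open>1\<close> and are positive. Values outside the unit disc carry no meaning.
\<close>
definition Omega :: "real \<Rightarrow> real \<Rightarrow> (complex \<Rightarrow> complex) \<Rightarrow> complex \<Rightarrow> complex" where
  "Omega \<alpha> \<mu> f z =
     z + (\<Sum>n. of_real (Omega_coeff \<alpha> \<mu> (n + 2)) * fps_nth (fps_expansion f 0) (n + 2) * z ^ (n + 2))"

end

theory Submission
  imports Defs
begin

text \<open>
  Put \<open>\<beta> = 1 / (\<mu> + 1)\<close>. The multipliers of the operator are quotients of Beta functions, the
  \<open>n\<close>-th one being \<open>Beta (n \<beta> + 1) \<alpha> / Beta (\<beta> + 1) \<alpha>\<close>
  (\<open>Omega_coeff_eq_Beta_quotient\<close>), and \<open>Beta (n \<beta> + 1) \<alpha>\<close> is the moment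
  \<open>\<integral> t powr (n \<beta>) * (1 - t) powr (\<alpha> - 1)\<close> over \<open>[0, 1]\<close>. Hence, up to the positive constant
  \<open>1 / Beta (\<beta> + 1) \<alpha>\<close>, the operator replaces \<open>f\<close> by an average of its dilations
  \<open>z \<mapsto> f (t powr \<beta> * z)\<close> against a nonnegative weight. It is convenient to split off one factor
  \<open>z\<close>: writing \<open>A u\<close> for the average of \<open>u (t powr \<beta> * z)\<close> with weight
  \<open>t powr \<beta> * (1 - t) powr (\<alpha> - 1)\<close>
  (\<open>beta_multiplier\<close>, \<open>has_integral_eval_beta_multiplier\<close>), the image \<open>F\<close> of \<open>f\<close> satisfies,
  with this constant omitted, both \<open>F z = z * A q z\<close> for \<open>q z = f z / z\<close>, and \<open>F' = A f'\<close>.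

  The second identity gives \<open>Re F' > 0\<close>, because a positively weighted average of values with
  positive real part has positive real part (\<open>Re_eval_beta_multiplier_pos\<close>).

  The first identity gives boundedness. Since \<open>f'\<close> has positive real part and value \<open>1\<close> at \<open>0\<close>,
  the Schwarz lemma applied to the Cayley transform of \<open>f'\<close> bounds \<open>f'\<close>, and therefore \<open>q\<close>, by
  \<open>2 / (1 - norm z)\<close> (\<open>Re_pos_growth\<close>, \<open>class_R_shift_growth\<close>). At the point
  \<open>t powr \<beta> * z\<close> this is at most a constant times \<open>1 / (1 - t)\<close>, uniformly in \<open>z\<close>, so the
  integrand is dominated by a multiple of \<open>(1 - t) powr (\<alpha> - 2)\<close>. That function is integrable
  because \<open>\<alpha> > 1\<close> (\<open>norm_eval_beta_multiplier_le\<close>).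
\<close>

section \<open>Beta multipliers as averages of dilations\<close>

text \<open>
  The shift from \<open>n\<close> to \<open>n + 1\<close> in the argument of Beta makes one operator serve both for
  \<open>f z / z\<close> and for \<open>f'\<close>: in either series the coefficient with index \<open>n\<close> comes from the
  coefficient of \<open>f\<close> with index \<open>n + 1\<close>.
\<close>
definition beta_multiplier :: "real \<Rightarrow> real \<Rightarrow> complex fps \<Rightarrow> complex fps" where
  "beta_multiplier \<alpha> \<beta> U = Abs_fps (\<lambda>n. of_real (Beta (\<beta> * real (n + 1) + 1) \<alpha>) * fps_nth U n)"

lemma Omega_coeff_eq_Beta_quotient:
  assumes "\<alpha> > 0" "\<mu> > -1"
  shows "Omega_coeff \<alpha> \<mu> n = Beta (real n / (\<mu> + 1) + 1) \<alpha> / Beta (1 / (\<mu> + 1) + 1) \<alpha>"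
proof -
  have "Gamma \<alpha> > 0"
    using assms by (simp add: Gamma_real_pos)
  then show ?thesis
    by (simp add: Omega_coeff_def Beta_def field_simps)
qed

lemma Beta_real_pos:
  assumes "a > 0" "b > (0::real)"
  shows "Beta a b > 0"
  using assms by (simp add: Beta_def Gamma_real_pos)

text \<open>
  The term-by-term integral of the series of \<open>U\<close> at \<open>t powr \<beta> * z\<close> is a Beta integral for each
  term. Integration and summation may be interchanged because the series converges uniformly in
  \<open>t\<close> by the Weierstrass test, the terms being dominated by their values at \<open>z\<close>. For \<open>\<alpha> > 1\<close>
  the weight is continuous on all of \<open>[0, 1]\<close>, so uniform convergence is enough.
\<close>
lemma beta_multiplier_sums_integral:
  assumes \<alpha>: "\<alpha> > 1" and \<beta>: "\<beta> > 0"
    and U: "fps_conv_radius U \<ge> 1" and z: "norm z < 1"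
  obtains I where
    "((\<lambda>t. of_real (t powr \<beta> * (1 - t) powr (\<alpha> - 1)) *
        eval_fps U (of_real (t powr \<beta>) * z)) has_integral I) {0..1}"
    "(\<lambda>n. fps_nth (beta_multiplier \<alpha> \<beta> U) n * z ^ n) sums I"
proof -
  define w where "w = (\<lambda>t::real. t powr \<beta> * (1 - t) powr (\<alpha> - 1))"
  define T where "T = (\<lambda>n t. of_real (w t) * (fps_nth U n * (of_real (t powr \<beta>) * z) ^ n))"
  have le1: "t powr \<beta> \<le> 1" if "t \<in> {0..1}" for t
    using that \<beta> powr_mono2[of \<beta> t 1] by simp
  have w_le1: "w t \<le> 1" "w t \<ge> 0" if "t \<in> {0..1}" for t
    using le1[OF that] that \<alpha> powr_mono2[of "\<alpha> - 1" "1 - t" 1]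
    unfolding w_def by (auto intro: mult_le_one)
  have bound: "norm (T n t) \<le> norm (fps_nth U n * z ^ n)" if "t \<in> {0..1}" for n t
  proof -
    have "norm (T n t) = w t * (t powr \<beta>) ^ n * norm (fps_nth U n * z ^ n)"
      using w_le1[OF that] by (simp add: T_def norm_mult norm_power power_mult_distrib)
    also have "\<dots> \<le> 1 * norm (fps_nth U n * z ^ n)"
      using w_le1[OF that] le1[OF that]
      by (intro mult_right_mono mult_le_one power_le_one) auto
    finally show ?thesis by simp
  qed
  have ball: "ereal (norm (of_real (t powr \<beta>) * z)) < fps_conv_radius U" if "t \<in> {0..1}" for t
  proof -
    have "norm (of_real (t powr \<beta>) * z) \<le> 1 * norm z"
      unfolding norm_mult using le1[OF that] by (intro mult_right_mono) auto
    with z have "ereal (norm (of_real (t powr \<beta>) * z)) < 1" by simp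
    then show ?thesis using U by (rule less_le_trans)
  qed
  have "summable (\<lambda>n. norm (fps_nth U n * z ^ n))"
    using z U by (intro norm_summable_fps) (metis ereal_less(3) less_le_trans)
  then have "uniform_limit {0..1} (\<lambda>N t. \<Sum>n<N. T n t) (\<lambda>t. \<Sum>n. T n t) sequentially"
    by (rule Weierstrass_m_test[rotated]) (rule bound)
  moreover have "(\<Sum>n. T n t) = of_real (w t) * eval_fps U (of_real (t powr \<beta>) * z)"
    if "t \<in> {0..1}" for t
    unfolding T_def using sums_mult[OF sums_eval_fps[OF ball[OF that]]] by (rule sums_unique [symmetric])
  ultimately have ul: "uniform_limit {0..1} (\<lambda>N t. \<Sum>n<N. T n t)
      (\<lambda>t. of_real (w t) * eval_fps U (of_real (t powr \<beta>) * z)) sequentially"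
    by (rule uniform_limit_cong'[THEN iffD1, OF refl, rotated])
  have cont: "continuous_on {0..1} (\<lambda>t. \<Sum>n<N. T n t)" for N
    unfolding T_def w_def using \<alpha> \<beta>
    by (intro continuous_intros continuous_on_powr') auto
  obtain I J where IJ: "\<And>N. ((\<lambda>t. \<Sum>n<N. T n t) has_integral I N) {0..1}"
      "((\<lambda>t. of_real (w t) * eval_fps U (of_real (t powr \<beta>) * z)) has_integral J) {0..1}"
      "I \<longlonglongrightarrow> J"
    using uniform_limit_integral[OF ul cont] by auto
  have "(T n has_integral fps_nth (beta_multiplier \<alpha> \<beta> U) n * z ^ n) {0..1}" for n
  proof -
    have "((\<lambda>t. t powr (\<beta> * real (n + 1)) * (1 - t) powr (\<alpha> - 1)) has_integral
        Beta (\<beta> * real (n + 1) + 1) \<alpha>) {0..1}"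
      using has_integral_Beta_real[of "\<beta> * real (n + 1) + 1" \<alpha>] \<alpha> \<beta>
      by (simp add: add_pos_nonneg)
    from has_integral_mult_left[OF has_integral_of_real[OF this], of "fps_nth U n * z ^ n"]
    have "((\<lambda>t. of_real (t powr (\<beta> * real (n + 1)) * (1 - t) powr (\<alpha> - 1)) * (fps_nth U n * z ^ n))
        has_integral fps_nth (beta_multiplier \<alpha> \<beta> U) n * z ^ n) {0..1}"
      by (simp add: beta_multiplier_def mult.assoc)
    \<comment> \<open>At \<open>t = 0\<close> both sides vanish, thanks to the factor \<open>t powr \<beta>\<close>, even though
      \<open>0 ^ 0 = 1\<close>.\<close>
    moreover have "t powr (\<beta> * real (n + 1)) = t powr \<beta> * (t powr \<beta>) ^ n" if "t \<in> {0..1}" for t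
      using that \<beta> by (cases "t = 0") (auto simp: powr_powr [symmetric] powr_realpow powr_add ring_distribs)
    ultimately show ?thesis
      by (subst has_integral_cong[where g = "\<lambda>t. of_real (t powr (\<beta> * real (n + 1)) * (1 - t) powr (\<alpha> - 1)) * (fps_nth U n * z ^ n)"])
         (simp_all add: T_def w_def power_mult_distrib mult_ac)
  qed
  then have "((\<lambda>t. \<Sum>n<N. T n t) has_integral (\<Sum>n<N. fps_nth (beta_multiplier \<alpha> \<beta> U) n * z ^ n)) {0..1}"
    for N
    by (intro has_integral_sum) auto
  then have "I = (\<lambda>N. \<Sum>n<N. fps_nth (beta_multiplier \<alpha> \<beta> U) n * z ^ n)"
    using IJ(1) has_integral_unique by blast
  then have "(\<lambda>n. fps_nth (beta_multiplier \<alpha> \<beta> U) n * z ^ n) sums J"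
    using IJ(3) by (simp add: sums_def)
  with IJ(2) show ?thesis
    unfolding w_def by (rule that)
qed

lemma fps_conv_radius_beta_multiplier:
  assumes "\<alpha> > 1" "\<beta> > 0" "fps_conv_radius U \<ge> 1"
  shows "fps_conv_radius (beta_multiplier \<alpha> \<beta> U) \<ge> 1"
  unfolding fps_conv_radius_def
proof (rule conv_radius_geI_ex')
  fix r :: real
  assume "0 < r" "ereal r < 1"
  then have "norm (of_real r :: complex) < 1"
    by simp
  from beta_multiplier_sums_integral[OF assms this]
  show "summable (\<lambda>n. fps_nth (beta_multiplier \<alpha> \<beta> U) n * of_real r ^ n)"
    by (metis sums_summable)
qed

lemma has_integral_eval_beta_multiplier:
  assumes "\<alpha> > 1" "\<beta> > 0" "fps_conv_radius U \<ge> 1" "norm z < 1"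
  shows "((\<lambda>t. of_real (t powr \<beta> * (1 - t) powr (\<alpha> - 1)) *
        eval_fps U (of_real (t powr \<beta>) * z)) has_integral
      eval_fps (beta_multiplier \<alpha> \<beta> U) z) {0..1}"
proof -
  obtain I where I: "((\<lambda>t. of_real (t powr \<beta> * (1 - t) powr (\<alpha> - 1)) *
        eval_fps U (of_real (t powr \<beta>) * z)) has_integral I) {0..1}"
      "(\<lambda>n. fps_nth (beta_multiplier \<alpha> \<beta> U) n * z ^ n) sums I"
    using beta_multiplier_sums_integral[OF assms] .
  then have "I = eval_fps (beta_multiplier \<alpha> \<beta> U) z"
    by (simp add: eval_fps_def sums_unique)
  with I(1) show ?thesis
    by simp
qed

text \<open>
  Strict positivity survives the integration because the dilated points stay in the closed disc of
  radius \<open>norm z\<close>, where by compactness the real part of \<open>U\<close> has a positive minimum \<open>m\<close>. The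
  average is then at least \<open>m\<close> times the total mass \<open>Beta (\<beta> + 1) \<alpha>\<close> of the weight.
\<close>
lemma Re_eval_beta_multiplier_pos:
  assumes \<alpha>: "\<alpha> > 1" and \<beta>: "\<beta> > 0" and U: "fps_conv_radius U \<ge> 1" and z: "norm z < 1"
    and pos: "\<And>w. norm w < 1 \<Longrightarrow> Re (eval_fps U w) > 0"
  shows "Re (eval_fps (beta_multiplier \<alpha> \<beta> U) z) > 0"
proof -
  have "cball (0::complex) (norm z) \<subseteq> eball 0 (fps_conv_radius U)"
  proof
    fix w :: complex
    assume "w \<in> cball 0 (norm z)"
    then have "ereal (norm w) < 1"
      using z by simp
    then show "w \<in> eball 0 (fps_conv_radius U)"
      using less_le_trans[OF _ U] by simp
  qed
  then have "continuous_on (cball 0 (norm z)) (\<lambda>w. Re (eval_fps U w))"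
    by (intro continuous_on_Re holomorphic_on_imp_continuous_on holomorphic_on_eval_fps)
  then obtain v where v: "norm v \<le> norm z"
      "\<And>w. norm w \<le> norm z \<Longrightarrow> Re (eval_fps U v) \<le> Re (eval_fps U w)"
    using continuous_attains_inf[of "cball 0 (norm z)" "\<lambda>w. Re (eval_fps U w)"] by auto
  define m where "m = Re (eval_fps U v)"
  have "m > 0"
    using v(1) z pos by (simp add: m_def)
  have "((\<lambda>t. t powr \<beta> * (1 - t) powr (\<alpha> - 1)) has_integral Beta (\<beta> + 1) \<alpha>) {0..1}"
    using has_integral_Beta_real[of "\<beta> + 1" \<alpha>] \<alpha> \<beta> by simp
  then have "((\<lambda>t. t powr \<beta> * (1 - t) powr (\<alpha> - 1) * m) has_integral Beta (\<beta> + 1) \<alpha> * m) {0..1}"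
    by (rule has_integral_mult_left)
  moreover have "((\<lambda>t. Re (of_real (t powr \<beta> * (1 - t) powr (\<alpha> - 1)) *
        eval_fps U (of_real (t powr \<beta>) * z))) has_integral
      Re (eval_fps (beta_multiplier \<alpha> \<beta> U) z)) {0..1}"
    using has_integral_linear[OF has_integral_eval_beta_multiplier[OF \<alpha> \<beta> U z] bounded_linear_Re]
    by (simp add: o_def)
  ultimately have "Beta (\<beta> + 1) \<alpha> * m \<le> Re (eval_fps (beta_multiplier \<alpha> \<beta> U) z)"
  proof (rule has_integral_le)
    fix t :: real
    assume t: "t \<in> {0..1}"
    have "t powr \<beta> \<le> 1"
      using t \<beta> powr_mono2[of \<beta> t 1] by simp
    then have "norm (of_real (t powr \<beta>) * z) \<le> norm z"
      by (simp add: norm_mult mult_left_le_one_le)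
    then have "m \<le> Re (eval_fps U (of_real (t powr \<beta>) * z))"
      unfolding m_def by (rule v(2))
    then show "t powr \<beta> * (1 - t) powr (\<alpha> - 1) * m \<le>
        Re (of_real (t powr \<beta> * (1 - t) powr (\<alpha> - 1)) * eval_fps U (of_real (t powr \<beta>) * z))"
      unfolding scaleR_conv_of_real [symmetric] scaleR_complex.sel by (intro mult_left_mono) simp_all
  qed
  moreover have "Beta (\<beta> + 1) \<alpha> * m > 0"
    using \<open>m > 0\<close> \<alpha> \<beta> by (intro mult_pos_pos Beta_real_pos) auto
  ultimately show ?thesis by simp
qed

text \<open>
  This compares the distance of \<open>t powr \<beta>\<close> from \<open>1\<close> with that of \<open>t\<close>. For \<open>\<beta> < 1\<close> it is the
  tangent line bound for a concave function, obtained here as weighted arithmetic-geometric mean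
  inequality between \<open>t\<close> and \<open>1\<close>.
\<close>
lemma one_minus_powr_ge:
  assumes "\<beta> > 0" and "0 < t" "t \<le> (1::real)"
  shows "min 1 \<beta> * (1 - t) \<le> 1 - t powr \<beta>"
proof (cases "\<beta> \<ge> 1")
  case True
  then show ?thesis
    using powr_le_one_le[of t \<beta>] assms by simp
next
  case False
  then have "t powr \<beta> * 1 powr (1 - \<beta>) \<le> \<beta> * t + (1 - \<beta>) * 1"
    using assms by (intro Youngs_inequality_0) auto
  then show ?thesis
    using False by (simp add: algebra_simps)
qed

text \<open>
  Averaging removes a simple pole on the boundary circle. The factor \<open>1 / (1 - norm w)\<close> at
  \<open>w = t powr \<beta> * z\<close> costs one power of \<open>1 - t\<close>, uniformly in \<open>z\<close>, and the remaining weight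
  \<open>(1 - t) powr (\<alpha> - 2)\<close> has the finite integral \<open>Beta 1 (\<alpha> - 1)\<close>.
\<close>
lemma norm_eval_beta_multiplier_le:
  assumes \<alpha>: "\<alpha> > 1" and \<beta>: "\<beta> > 0" and U: "fps_conv_radius U \<ge> 1" and z: "norm z < 1"
    and growth: "\<And>w. norm w < 1 \<Longrightarrow> norm (eval_fps U w) \<le> C / (1 - norm w)"
  shows "norm (eval_fps (beta_multiplier \<alpha> \<beta> U) z) \<le> Beta 1 (\<alpha> - 1) * (C / min 1 \<beta>)"
proof -
  have "C \<ge> 0"
    using order_trans[OF norm_ge_zero growth[of 0]] by simp
  \<comment> \<open>The dominating function is kept in the form of the Beta integrand; its value at \<open>t = 0\<close>
    is \<open>0\<close>, which does no harm since the weight vanishes there as well.\<close>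
  have "((\<lambda>t. t powr 0 * (1 - t) powr (\<alpha> - 1 - 1)) has_integral Beta 1 (\<alpha> - 1)) {0..1}"
    using has_integral_Beta_real[of 1 "\<alpha> - 1"] \<alpha> by simp
  then have g: "((\<lambda>t. t powr 0 * (1 - t) powr (\<alpha> - 1 - 1) * (C / min 1 \<beta>)) has_integral
      Beta 1 (\<alpha> - 1) * (C / min 1 \<beta>)) {0..1}"
    by (rule has_integral_mult_left)
  note h = has_integral_eval_beta_multiplier[OF \<alpha> \<beta> U z]
  have "norm (of_real (t powr \<beta> * (1 - t) powr (\<alpha> - 1)) * eval_fps U (of_real (t powr \<beta>) * z))
      \<le> t powr 0 * (1 - t) powr (\<alpha> - 1 - 1) * (C / min 1 \<beta>)" if t: "t \<in> {0..1}" for t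
  proof (cases "t = 0 \<or> t = 1")
    case False
    with t have t': "0 < t" "t < 1" by auto
    have le1: "t powr \<beta> \<le> 1"
      using t \<beta> powr_mono2[of \<beta> t 1] by simp
    have n: "norm (of_real (t powr \<beta>) * z) \<le> t powr \<beta>"
      using z by (simp add: norm_mult mult_left_le)
    have lt1: "norm (of_real (t powr \<beta>) * z) < 1"
      using z le1 by (simp add: norm_mult) (meson le_less_trans mult_left_le_one_le norm_ge_zero powr_ge_zero)
    from growth[OF lt1]
    have "norm (eval_fps U (of_real (t powr \<beta>) * z)) \<le> C / (1 - norm (of_real (t powr \<beta>) * z))" .
    also have "\<dots> \<le> C / (min 1 \<beta> * (1 - t))"
      using one_minus_powr_ge[OF \<beta>, of t] n t' \<beta> \<open>C \<ge> 0\<close> lt1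
      by (intro divide_left_mono mult_pos_pos) auto
    finally have 1: "norm (eval_fps U (of_real (t powr \<beta>) * z)) \<le> C / (min 1 \<beta> * (1 - t))" .
    have 2: "(1 - t) powr (\<alpha> - 1) = (1 - t) powr (\<alpha> - 1 - 1) * (1 - t)"
      using t' powr_add[of "1 - t" "\<alpha> - 1 - 1" 1] by simp
    have "norm (of_real (t powr \<beta> * (1 - t) powr (\<alpha> - 1)) * eval_fps U (of_real (t powr \<beta>) * z))
        = t powr \<beta> * (1 - t) powr (\<alpha> - 1) * norm (eval_fps U (of_real (t powr \<beta>) * z))"
      by (simp add: norm_mult)
    also have "\<dots> \<le> 1 * (1 - t) powr (\<alpha> - 1) * (C / (min 1 \<beta> * (1 - t)))"
      using le1 1 by (intro mult_mono) auto
    also have "\<dots> = t powr 0 * (1 - t) powr (\<alpha> - 1 - 1) * (C / min 1 \<beta>)"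
      unfolding 2 using t' by simp
    finally show ?thesis .
  qed (use \<alpha> \<beta> \<open>C \<ge> 0\<close> in auto)
  then have "norm (integral {0..1} (\<lambda>t. of_real (t powr \<beta> * (1 - t) powr (\<alpha> - 1)) * eval_fps U (of_real (t powr \<beta>) * z)))
      \<le> integral {0..1} (\<lambda>t. t powr 0 * (1 - t) powr (\<alpha> - 1 - 1) * (C / min 1 \<beta>))"
    using g h by (intro integral_norm_bound_integral) (auto intro: has_integral_integrable)
  then show ?thesis
    using g h by (simp only: integral_unique)
qed

section \<open>Growth of functions with positive real part\<close>

text \<open>
  The Cayley transform \<open>(p - 1) / (p + 1)\<close> maps the right half plane to the unit disc and takes
  \<open>p 0 = 1\<close> to \<open>0\<close>. By the Schwarz lemma its modulus at \<open>z\<close> is at most \<open>norm z\<close>; solving for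
  \<open>p\<close> gives \<open>(1 + norm z) / (1 - norm z)\<close>, and \<open>2\<close> is a sufficient bound for the numerator.
\<close>
lemma Re_pos_growth:
  assumes hol: "p holomorphic_on unit_disc" and "p 0 = 1"
    and pos: "\<And>w. w \<in> unit_disc \<Longrightarrow> Re (p w) > 0" and z: "z \<in> unit_disc"
  shows "norm (p z) \<le> 2 / (1 - norm z)"
proof -
  define g where "g = (\<lambda>w. (p w - 1) / (p w + 1))"
  have nz: "p w + 1 \<noteq> 0" if "w \<in> unit_disc" for w
    using pos[OF that] by (auto simp: complex_eq_iff)
  have "g holomorphic_on unit_disc"
    unfolding g_def using nz by (intro holomorphic_intros hol) auto
  moreover have "norm (g w) < 1" if "norm w < 1" for w
  proof -
    have "(norm (p w - 1))\<^sup>2 < (norm (p w + 1))\<^sup>2"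
      using pos[of w] that unfolding cmod_power2 by (simp add: power2_eq_square algebra_simps)
    then have "norm (p w - 1) < norm (p w + 1)"
      by (rule power_less_imp_less_base) simp
    then show ?thesis
      using nz[of w] that by (simp add: g_def norm_divide)
  qed
  ultimately have g: "norm (g z) \<le> norm z"
    using Schwarz_Lemma(1)[of g z] z \<open>p 0 = 1\<close> by (simp add: g_def)
  have "p z - 1 = g z * (p z + 1)"
    using nz[OF z] by (simp add: g_def)
  then have "p z * (1 - g z) = 1 + g z"
    by (simp add: algebra_simps)
  then have eq: "norm (p z) * norm (1 - g z) = norm (1 + g z)"
    by (metis norm_mult)
  have "norm (p z) * (1 - norm z) \<le> norm (p z) * norm (1 - g z)"
    using norm_triangle_ineq2[of 1 "g z"] g by (intro mult_left_mono) auto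
  also have "\<dots> \<le> 2"
    unfolding eq using norm_triangle_ineq[of 1 "g z"] g z by simp
  finally show ?thesis
    using z by (simp add: field_simps)
qed

section \<open>Normalised functions and their power series\<close>

lemma class_A_fps_expansion:
  assumes "f \<in> class_A"
  defines "B \<equiv> fps_expansion f 0"
  shows "fps_conv_radius B \<ge> 1" "fps_nth B 0 = 0" "fps_nth B 1 = 1"
    and "\<forall>z\<in>unit_disc. f z = eval_fps B z"
proof -
  have hol: "f holomorphic_on eball 0 1"
    using assms by (simp add: class_A_def class_H_def one_ereal_def)
  show "fps_conv_radius B \<ge> 1"
    unfolding B_def by (rule conv_radius_fps_expansion[OF hol])
  show "\<forall>z\<in>unit_disc. f z = eval_fps B z"
    unfolding B_def using eval_fps_expansion'[OF hol] by (auto simp: one_ereal_def)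
  obtain a where a: "\<And>z. z \<in> unit_disc \<Longrightarrow> (\<lambda>n. a (n + 2) * z ^ (n + 2)) sums (f z - z)"
    using assms(1) unfolding class_A_def by blast
  define A where "A = Abs_fps (\<lambda>n. if n = 0 then 0 else if n = 1 then 1 else a n)"
  have "(\<lambda>n. fps_nth A n * z ^ n) sums f z" if "z \<in> unit_disc" for z
  proof (subst sums_iff_shift' [of _ 2, symmetric])
    show "(\<lambda>n. fps_nth A (n + 2) * z ^ (n + 2)) sums (f z - (\<Sum>n<2. fps_nth A n * z ^ n))"
      using a[OF that] by (simp add: A_def numeral_2_eq_2)
  qed
  then have "f has_fps_expansion A"
    by (intro has_fps_expansionI eventually_nhds_in_open[THEN eventually_mono, of unit_disc]) auto
  then have "B = A"
    unfolding B_def by (rule fps_expansion_eqI)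
  then show "fps_nth B 0 = 0" "fps_nth B 1 = 1"
    by (simp_all add: A_def)
qed

lemma eq_eval_fps_imp_class_A:
  assumes G: "fps_conv_radius G \<ge> 1" "fps_nth G 0 = 0" "fps_nth G 1 = 1"
    and F: "\<forall>z\<in>unit_disc. F z = eval_fps G z"
  shows "F \<in> class_A"
    and "\<And>z. z \<in> unit_disc \<Longrightarrow> deriv F z = eval_fps (fps_deriv G) z"
proof -
  have conv: "ereal (norm z) < fps_conv_radius G" if "z \<in> unit_disc" for z
    using that G(1) less_le_trans[of "ereal (norm z)" 1 "fps_conv_radius G"] by simp
  have "eval_fps G holomorphic_on unit_disc"
    using conv by (intro holomorphic_on_eval_fps) auto
  then have "F holomorphic_on unit_disc"
    using F by (subst holomorphic_cong[OF refl]) auto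
  moreover have "(\<lambda>n. fps_nth G (n + 2) * z ^ (n + 2)) sums (F z - z)" if "z \<in> unit_disc" for z
    using sums_split_initial_segment[OF sums_eval_fps[OF conv[OF that]], of 2] bspec[OF F that] G(2,3)
    by (simp add: numeral_2_eq_2)
  ultimately show "F \<in> class_A"
    unfolding class_A_def class_H_def by blast
  show "deriv F z = eval_fps (fps_deriv G) z" if "z \<in> unit_disc" for z
  proof -
    have "eventually (\<lambda>w. w \<in> unit_disc) (nhds z)"
      using that by (intro eventually_nhds_in_open) auto
    then have "eventually (\<lambda>w. F w = eval_fps G w) (nhds z)"
      by eventually_elim (rule bspec[OF F])
    then show ?thesis
      by (subst eval_fps_deriv[OF conv[OF that]]) (rule deriv_cong_ev, auto)
  qed
qed

text \<open>
  The shifted series represents \<open>f z / z\<close>, with the singularity at \<open>0\<close> removed. By the mean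
  value inequality on the closed disc of radius \<open>norm z\<close> this quotient is bounded by the supremum
  of \<open>f'\<close> there, so the bound of \<open>Re_pos_growth\<close> for \<open>f'\<close> carries over.
\<close>
lemma class_R_shift_growth:
  assumes f: "f \<in> class_R" and z: "norm z < 1"
  shows "norm (eval_fps (fps_shift 1 (fps_expansion f 0)) z) \<le> 2 / (1 - norm z)"
proof -
  define B where "B = fps_expansion f 0"
  have "f \<in> class_A"
    using f by (simp add: class_R_def)
  note B = class_A_fps_expansion[OF this, folded B_def]
  have conv: "ereal (norm w) < fps_conv_radius B" if "norm w < 1" for w :: complex
    using that B(1) less_le_trans[of "ereal (norm w)" 1 "fps_conv_radius B"] by simp
  have "f holomorphic_on unit_disc"
    using f by (simp add: class_R_def class_A_def class_H_def)
  have d0: "deriv f 0 = 1"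
    using eq_eval_fps_imp_class_A(2)[OF B, of 0] B(3) by (simp add: eval_fps_at_0)
  have growth: "norm (deriv f w) \<le> 2 / (1 - norm z)" if "norm w \<le> norm z" for w
  proof -
    have "norm (deriv f w) \<le> 2 / (1 - norm w)"
      using \<open>f holomorphic_on unit_disc\<close> f d0 that z
      by (intro Re_pos_growth holomorphic_deriv) (auto simp: class_R_def)
    also have "\<dots> \<le> 2 / (1 - norm z)"
      using that z by (intro divide_left_mono mult_pos_pos) auto
    finally show ?thesis .
  qed
  have "norm (f z - f 0) \<le> 2 / (1 - norm z) * norm (z - 0)"
  proof (rule field_differentiable_bound[of "cball 0 (norm z)" f "deriv f"])
    show "(f has_field_derivative deriv f w) (at w within cball 0 (norm z))"
      if "w \<in> cball 0 (norm z)" for w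
      using that z \<open>f holomorphic_on unit_disc\<close>
      by (intro holomorphic_derivI[of _ unit_disc]) auto
  qed (use growth in auto)
  moreover have "f 0 = 0"
    using B(2) bspec[OF B(4), of 0] by (simp add: eval_fps_at_0)
  ultimately have fz: "norm (f z) \<le> 2 / (1 - norm z) * norm z"
    by simp
  have "subdegree B \<ge> 1"
    using B(2,3) by (intro subdegree_geI) auto
  then have "eval_fps (fps_shift 1 B) z = (if z = 0 then 1 else f z / z)"
    using eval_fps_shift[of 1 B z] conv[OF z] B(3) bspec[OF B(4), of z] z by simp
  then show ?thesis
    using fz z by (auto simp: B_def [symmetric] norm_divide field_simps)
qed

section \<open>The operator preserves the class and yields bounded functions\<close>

theorem theorem2p3:
  fixes \<alpha> \<mu> :: real and f :: "complex \<Rightarrow> complex"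
  assumes "\<alpha> > 1" and "\<mu> > -1" and "f \<in> class_R"
  shows "Omega \<alpha> \<mu> f \<in> class_R \<inter> class_H_inf"
proof -
  define \<beta> where "\<beta> = 1 / (\<mu> + 1)"
  define K where "K = Beta (\<beta> + 1) \<alpha>"
  define B where "B = fps_expansion f 0"
  define Q where "Q = beta_multiplier \<alpha> \<beta> (fps_shift 1 B)"
  define G where "G = fps_const (of_real (1 / K)) * (fps_X * Q)"
  have \<beta>: "\<beta> > 0"
    using assms by (simp add: \<beta>_def)
  have K: "K > 0"
    unfolding K_def using assms \<beta> by (intro Beta_real_pos) auto
  have "f \<in> class_A"
    using assms by (simp add: class_R_def)
  note B = class_A_fps_expansion[OF this, folded B_def]
  have B': "fps_conv_radius (fps_deriv B) \<ge> 1"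
    using B(1) fps_conv_radius_deriv order_trans by blast
  have Q: "fps_conv_radius Q \<ge> 1"
    unfolding Q_def using assms \<beta> B(1) by (intro fps_conv_radius_beta_multiplier) auto
  have XQ: "fps_conv_radius (fps_X * Q) \<ge> 1"
    using fps_conv_radius_mult[of fps_X Q] Q by simp
  have G_radius: "fps_conv_radius G \<ge> 1"
    unfolding G_def using fps_conv_radius_mult[of "fps_const (of_real (1 / K))" "fps_X * Q"] XQ
    by simp
  have conv: "ereal (norm z) < 1" if "z \<in> unit_disc" for z :: complex
    using that by simp
  have G_eval: "eval_fps G z = of_real (1 / K) * (z * eval_fps Q z)" if "z \<in> unit_disc" for z
    unfolding G_def using less_le_trans[OF conv[OF that] Q] less_le_trans[OF conv[OF that] XQ]
    by (simp add: eval_fps_mult)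
  have G0: "fps_nth G 0 = 0"
    by (simp add: G_def)
  have G_nth: "fps_nth G n = of_real (Omega_coeff \<alpha> \<mu> n) * fps_nth B n" if "n > 0" for n
    using that assms
    by (simp add: G_def Q_def beta_multiplier_def Omega_coeff_eq_Beta_quotient K_def \<beta>_def)
  have G1: "fps_nth G 1 = 1"
    using K B(3) assms by (subst G_nth) (auto simp: Omega_coeff_eq_Beta_quotient K_def \<beta>_def)
  have \<Omega>: "\<forall>z\<in>unit_disc. Omega \<alpha> \<mu> f z = eval_fps G z"
  proof
    fix z :: complex
    assume that: "z \<in> unit_disc"
    have "(\<lambda>n. fps_nth G (n + 2) * z ^ (n + 2)) sums (eval_fps G z - z)"
      using sums_split_initial_segment[OF sums_eval_fps[OF less_le_trans[OF conv[OF that] G_radius]], of 2]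
        G0 G1 by (simp add: numeral_2_eq_2)
    then show "Omega \<alpha> \<mu> f z = eval_fps G z"
      by (simp add: Omega_def B_def [symmetric] G_nth sums_iff)
  qed
  note \<Omega>_class = eq_eval_fps_imp_class_A[OF G_radius G0 G1 \<Omega>]
  \<comment> \<open>The factor \<open>n + 1\<close> produced by differentiation commutes with the coefficientwise
    multiplier, so \<open>F'\<close> is the average of \<open>f'\<close>.\<close>
  have G': "fps_deriv G = fps_const (of_real (1 / K)) * beta_multiplier \<alpha> \<beta> (fps_deriv B)"
    by (rule fps_ext) (simp add: G_def Q_def beta_multiplier_def algebra_simps add_divide_distrib)
  have "Re (deriv (Omega \<alpha> \<mu> f) z) > 0" if z: "z \<in> unit_disc" for z
  proof -
    have "Re (eval_fps (fps_deriv B) w) > 0" if "norm w < 1" for w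
    proof -
      have w: "w \<in> unit_disc"
        using that by simp
      have "deriv f w = eval_fps (fps_deriv B) w"
        using eq_eval_fps_imp_class_A(2)[OF B] w by blast
      moreover have "Re (deriv f w) > 0"
        using assms(3) w unfolding class_R_def by blast
      ultimately show ?thesis
        by simp
    qed
    then have "Re (eval_fps (beta_multiplier \<alpha> \<beta> (fps_deriv B)) z) > 0"
      using assms \<beta> B' z by (intro Re_eval_beta_multiplier_pos) auto
    moreover have "deriv (Omega \<alpha> \<mu> f) z =
        of_real (1 / K) * eval_fps (beta_multiplier \<alpha> \<beta> (fps_deriv B)) z"
      using less_le_trans[OF conv[OF z] fps_conv_radius_beta_multiplier[OF assms(1) \<beta> B']] \<Omega>_class(2)[OF z]
      by (simp add: G' eval_fps_mult)
    ultimately show ?thesis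
      using K by (simp only: scaleR_conv_of_real [symmetric] scaleR_complex.sel) simp
  qed
  with \<Omega>_class(1) have "Omega \<alpha> \<mu> f \<in> class_R"
    by (simp add: class_R_def)
  moreover have "bounded (Omega \<alpha> \<mu> f ` unit_disc)"
  proof (rule boundedI)
    fix y
    assume "y \<in> Omega \<alpha> \<mu> f ` unit_disc"
    then obtain z where z: "z \<in> unit_disc" "y = Omega \<alpha> \<mu> f z" by auto
    have "norm (eval_fps Q z) \<le> Beta 1 (\<alpha> - 1) * (2 / min 1 \<beta>)"
      unfolding Q_def B_def using z assms \<beta> B(1)
      by (intro norm_eval_beta_multiplier_le class_R_shift_growth) (auto simp: B_def)
    then show "norm y \<le> 1 / K * (1 * (Beta 1 (\<alpha> - 1) * (2 / min 1 \<beta>)))"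
      unfolding z(2) bspec[OF \<Omega> z(1)] G_eval[OF z(1)] norm_mult norm_of_real
      using K z(1) by (intro mult_mono) auto
  qed
  ultimately show ?thesis
    by (auto simp: class_H_inf_def class_R_def class_A_def)
qed

end
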